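(* Let $\Delta\ge 1$, $\varepsilon>0$, and let $(G=(V,E),\mathcal L)$ be a $((1+\varepsilon)\Delta+1)$-extra list edge coloring instance where $G$ has maximum degree at most $\Delta$, and let $\mu$ be the uniform distribution on its proper edge colorings. Then for every edge $i\in E$ and all colors $a,b\in\mathcal L(i)$, \[\mathcal W_1\big(\mu_E^{i\leftarrow a},\mu_E^{i\leftarrow b}\big)\le 1+\frac{2}{\varepsilon},\] i.e. $\mu$ is $(1+2/\varepsilon)$-coupling independent in this sense.
   Context: A list edge coloring instance is a pair $(G,\mathcal L)$, $G=(V,E)$ a finite undirected graph, $\mathcal L(e)\subseteq[q]$ a color list for each $e\in E$. For $e\in E$, $\deg(e)$ is the number of edges other than $e$ sharing an endpoint with $e$. A proper edge coloring is $\sigma:E\to[q]$ with $\sigma(e)\in\mathcal L(e)$ and $\sigma(e_1)\neq\sigma(e_2)$ for distinct edges sharing an endpoint. The instance is $\beta$-extra if $|\mathcal L(e)|\ge\deg(e)+\beta$ for all $e$. For a pinning $i\leftarrow c$, $\mu^{i\leftarrow c}$ denotes $\mu$ conditioned on edge $i$ receiving color $c$, and $\mu^{i\leftarrow c}_S$ its marginal on the edge set $S$. For distributions $\nu_1,\nu_2$ on a finite set with metric $d$, $\mathcal W_1(\nu_1,\nu_2)=\inf_{\omega}\mathbb E_{(x,y)\sim\omega}[d(x,y)]$ over all couplings $\omega$ of $\nu_1,\nu_2$; here $d$ is the Hamming distance (number of edges colored differently). *)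

theory Defs
  imports "HOL-Probability.Probability" "HOL-Library.FuncSet"
begin

definition finite_graph :: "'v set \<Rightarrow> 'v set set \<Rightarrow> bool" where
  "finite_graph V E \<longleftrightarrow> finite V \<and> (\<forall>e\<in>E. e \<subseteq> V \<and> card e = 2)"

definition vertex_degree :: "'v set set \<Rightarrow> 'v \<Rightarrow> nat" where
  "vertex_degree E v = card {e \<in> E. v \<in> e}"

definition edge_degree :: "'v set set \<Rightarrow> 'v set \<Rightarrow> nat" where
  "edge_degree E e = card {f \<in> E. f \<noteq> e \<and> f \<inter> e \<noteq> {}}"

definition list_edge_coloring_instance ::
    "'v set \<Rightarrow> 'v set set \<Rightarrow> nat \<Rightarrow> ('v set \<Rightarrow> nat set) \<Rightarrow> bool" where
  "list_edge_coloring_instance V E q L \<longleftrightarrow> finite_graph V E \<and> (\<forall>e\<in>E. L e \<subseteq> {1..q})"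

definition extra :: "real \<Rightarrow> 'v set set \<Rightarrow> ('v set \<Rightarrow> nat set) \<Rightarrow> bool" where
  "extra \<beta> E L \<longleftrightarrow> (\<forall>e\<in>E. real (card (L e)) \<ge> real (edge_degree E e) + \<beta>)"

text \<open>Colorings are extensional functions, so that each map from \<open>E\<close> to \<open>[q]\<close> is
  represented exactly once and the uniform distribution below is the intended one.\<close>

definition proper_edge_colorings ::
    "'v set set \<Rightarrow> nat \<Rightarrow> ('v set \<Rightarrow> nat set) \<Rightarrow> ('v set \<Rightarrow> nat) set" where
  "proper_edge_colorings E q L =
     {\<sigma> \<in> E \<rightarrow>\<^sub>E {1..q}. (\<forall>e\<in>E. \<sigma> e \<in> L e) \<and>
        (\<forall>e\<in>E. \<forall>f\<in>E. e \<noteq> f \<and> e \<inter> f \<noteq> {} \<longrightarrow> \<sigma> e \<noteq> \<sigma> f)}"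

definition uniform_edge_coloring ::
    "'v set set \<Rightarrow> nat \<Rightarrow> ('v set \<Rightarrow> nat set) \<Rightarrow> ('v set \<Rightarrow> nat) pmf" where
  "uniform_edge_coloring E q L = pmf_of_set (proper_edge_colorings E q L)"

definition pinned :: "('e \<Rightarrow> 'c) pmf \<Rightarrow> 'e \<Rightarrow> 'c \<Rightarrow> ('e \<Rightarrow> 'c) pmf" where
  "pinned \<mu> i c = cond_pmf \<mu> {\<sigma>. \<sigma> i = c}"

definition marginal :: "('e \<Rightarrow> 'c) pmf \<Rightarrow> 'e set \<Rightarrow> ('e \<Rightarrow> 'c) pmf" where
  "marginal \<mu> S = map_pmf (\<lambda>\<sigma>. restrict \<sigma> S) \<mu>"

definition couplings :: "'a pmf \<Rightarrow> 'a pmf \<Rightarrow> ('a \<times> 'a) pmf set" where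
  "couplings \<nu>\<^sub>1 \<nu>\<^sub>2 = {\<omega>. map_pmf fst \<omega> = \<nu>\<^sub>1 \<and> map_pmf snd \<omega> = \<nu>\<^sub>2}"

definition wasserstein1 :: "('a \<Rightarrow> 'a \<Rightarrow> real) \<Rightarrow> 'a pmf \<Rightarrow> 'a pmf \<Rightarrow> real" where
  "wasserstein1 d \<nu>\<^sub>1 \<nu>\<^sub>2 =
     (INF \<omega>\<in>couplings \<nu>\<^sub>1 \<nu>\<^sub>2. measure_pmf.expectation \<omega> (\<lambda>(x, y). d x y))"

definition hamming :: "'e set \<Rightarrow> ('e \<Rightarrow> 'c) \<Rightarrow> ('e \<Rightarrow> 'c) \<Rightarrow> real" where
  "hamming S x y = real (card {e \<in> S. x e \<noteq> y e})"

end

theory Submission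
  imports Defs
begin

text \<open>
  Pinning the edge \<open>{u, w}\<close> to \<open>c\<close> amounts to deleting it and removing \<open>c\<close> from the lists at \<open>u\<close> and
  at \<open>w\<close>. So if changing the color removed at one vertex costs at most \<open>D\<close>, then changing the color of
  a pinned edge costs at most \<open>1 + 2 * D\<close>, and the theorem follows from \<open>D = 1 / \<epsilon>\<close>.

  This \<open>D\<close> is obtained by induction on the edge set. Let \<open>X\<close> and \<open>Y\<close> be the colorings for the lists with
  \<open>a\<close>, respectively \<open>b\<close>, removed at \<open>u\<close>. The colorings using neither color at \<open>u\<close> are common to \<open>X\<close> and
  \<open>Y\<close>. In the others exactly one edge \<open>e\<close> at \<open>u\<close> has color \<open>b\<close>, respectively \<open>a\<close>; recoloring \<open>e\<close> shows that
  for each \<open>e\<close> these classes \<open>X\<^sub>e\<close> and \<open>Y\<^sub>e\<close> have at most \<open>1 / ((1 + \<epsilon>) * \<Delta>)\<close> times the size of the common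
  part. Pad the smaller of \<open>X\<^sub>e\<close> and \<open>Y\<^sub>e\<close> to the size of the larger by copies of the uniform distribution
  on all of \<open>X\<close> or \<open>Y\<close>, which leaves the mixtures unchanged. The padded classes, which carry at most the
  fraction \<open>1 / (2 + \<epsilon>)\<close> of the mass, then differ only in the color to which \<open>e\<close> is pinned, once the
  padding is conditioned on the color of \<open>e\<close>. By the induction hypothesis they are matched at cost
  \<open>1 + 2 * D\<close>, and \<open>(1 + 2 * D) / (2 + \<epsilon>) = D\<close>.
\<close>

section \<open>Couplings of bounded cost\<close>

text \<open>The nonnegative integral makes integrability side conditions unnecessary; negative values of \<open>d\<close>
  and \<open>K\<close> count as \<open>0\<close>.\<close>

definition coupled_within :: "('a \<Rightarrow> 'a \<Rightarrow> real) \<Rightarrow> real \<Rightarrow> 'a pmf \<Rightarrow> 'a pmf \<Rightarrow> bool" where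
  "coupled_within d K \<mu> \<nu> \<longleftrightarrow>
     (\<exists>\<omega>\<in>couplings \<mu> \<nu>. (\<integral>\<^sup>+z. ennreal (d (fst z) (snd z)) \<partial>measure_pmf \<omega>) \<le> ennreal K)"

lemma coupled_withinI:
  assumes "map_pmf fst \<omega> = \<mu>" "map_pmf snd \<omega> = \<nu>"
    and "(\<integral>\<^sup>+z. ennreal (d (fst z) (snd z)) \<partial>measure_pmf \<omega>) \<le> ennreal K"
  shows "coupled_within d K \<mu> \<nu>"
  using assms unfolding coupled_within_def couplings_def by blast

lemma coupled_withinE:
  assumes "coupled_within d K \<mu> \<nu>"
  obtains \<omega> where "map_pmf fst \<omega> = \<mu>" "map_pmf snd \<omega> = \<nu>"
    and "(\<integral>\<^sup>+z. ennreal (d (fst z) (snd z)) \<partial>measure_pmf \<omega>) \<le> ennreal K"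
  using assms unfolding coupled_within_def couplings_def by blast

lemma wasserstein1_le:
  assumes "coupled_within d K \<mu> \<nu>" "\<And>x y. 0 \<le> d x y" "0 \<le> K"
  shows "wasserstein1 d \<mu> \<nu> \<le> K"
proof -
  obtain \<omega> where \<omega>: "\<omega> \<in> couplings \<mu> \<nu>"
    and cost: "(\<integral>\<^sup>+z. ennreal (d (fst z) (snd z)) \<partial>measure_pmf \<omega>) \<le> ennreal K"
    using assms(1) unfolding coupled_within_def by blast
  have "bdd_below ((\<lambda>\<omega>. measure_pmf.expectation \<omega> (\<lambda>(x, y). d x y)) ` couplings \<mu> \<nu>)"
    using assms(2) by (intro bdd_belowI2[where m = 0] integral_nonneg_AE) auto
  then have "wasserstein1 d \<mu> \<nu> \<le> measure_pmf.expectation \<omega> (\<lambda>(x, y). d x y)"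
    unfolding wasserstein1_def using \<omega> by (rule cINF_lower)
  also have "\<dots> = enn2real (\<integral>\<^sup>+z. ennreal (d (fst z) (snd z)) \<partial>measure_pmf \<omega>)"
    using assms(2) by (simp add: integral_eq_nn_integral split_beta)
  also have "\<dots> \<le> K"
    using assms(3) cost by (rule enn2real_leI)
  finally show ?thesis .
qed

lemma coupled_within_refl:
  assumes "\<And>x. d x x = 0"
  shows "coupled_within d K \<mu> \<mu>"
  by (rule coupled_withinI[where \<omega> = "map_pmf (\<lambda>x. (x, x)) \<mu>"])
    (simp_all add: map_pmf_comp assms)

lemma coupled_within_mono:
  "coupled_within d K \<mu> \<nu> \<Longrightarrow> K \<le> K' \<Longrightarrow> coupled_within d K' \<mu> \<nu>"
  unfolding coupled_within_def by (meson ennreal_leI order_trans)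

lemma coupled_within_sym:
  assumes "coupled_within d K \<mu> \<nu>" "\<And>x y. d x y = d y x"
  shows "coupled_within d K \<nu> \<mu>"
proof -
  obtain \<omega> where "map_pmf fst \<omega> = \<mu>" "map_pmf snd \<omega> = \<nu>"
    "(\<integral>\<^sup>+z. ennreal (d (fst z) (snd z)) \<partial>measure_pmf \<omega>) \<le> ennreal K"
    using assms(1) by (rule coupled_withinE)
  then show ?thesis
    by (intro coupled_withinI[where \<omega> = "map_pmf prod.swap \<omega>"])
      (simp_all add: map_pmf_comp assms(2)[of "snd _"])
qed

lemma glue_couplings:
  assumes marginals: "map_pmf snd \<omega> = map_pmf fst \<omega>'"
  obtains \<tau> where "map_pmf fst \<tau> = \<omega>" "map_pmf snd \<tau> = \<omega>'"
    and "\<And>w. w \<in> set_pmf \<tau> \<Longrightarrow> snd (fst w) = fst (snd w)"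
proof
  define \<tau> where "\<tau> = bind_pmf \<omega> (\<lambda>s. map_pmf (Pair s) (cond_pmf \<omega>' {t. snd s = fst t}))"
  show "map_pmf fst \<tau> = \<omega>"
    by (simp add: \<tau>_def map_bind_pmf map_pmf_comp bind_return_pmf')
  have "bind_pmf (map_pmf fst \<omega>') (\<lambda>y. cond_pmf \<omega>' {t. y = fst t}) = \<omega>'"
    by (intro bind_cond_pmf_cancel) (force simp: vimage_def eq_commute)+
  then show "map_pmf snd \<tau> = \<omega>'"
    by (simp add: \<tau>_def map_bind_pmf map_pmf_comp bind_map_pmf flip: marginals)
  show "snd (fst w) = fst (snd w)" if "w \<in> set_pmf \<tau>" for w
  proof -
    have "set_pmf \<omega>' \<inter> {t. snd s = fst t} \<noteq> {}" if "s \<in> set_pmf \<omega>" for s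
    proof -
      have "snd s \<in> fst ` set_pmf \<omega>'"
        using that by (metis marginals imageI pmf.set_map)
      then show ?thesis by auto
    qed
    with that show ?thesis by (auto simp: \<tau>_def)
  qed
qed

lemma coupled_within_trans:
  assumes "coupled_within d K \<mu> \<nu>" "coupled_within d K' \<nu> \<rho>"
    and triangle: "\<And>x y z. d x z \<le> d x y + d y z"
    and nonneg: "\<And>x y. 0 \<le> d x y" "0 \<le> K" "0 \<le> K'"
  shows "coupled_within d (K + K') \<mu> \<rho>"
proof -
  obtain \<omega> where \<omega>: "map_pmf fst \<omega> = \<mu>" "map_pmf snd \<omega> = \<nu>"
    and cost: "(\<integral>\<^sup>+z. ennreal (d (fst z) (snd z)) \<partial>measure_pmf \<omega>) \<le> ennreal K"
    using assms(1) by (rule coupled_withinE)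
  obtain \<omega>' where \<omega>': "map_pmf fst \<omega>' = \<nu>" "map_pmf snd \<omega>' = \<rho>"
    and cost': "(\<integral>\<^sup>+z. ennreal (d (fst z) (snd z)) \<partial>measure_pmf \<omega>') \<le> ennreal K'"
    using assms(2) by (rule coupled_withinE)
  obtain \<tau> where \<tau>: "map_pmf fst \<tau> = \<omega>" "map_pmf snd \<tau> = \<omega>'"
    and glued: "\<And>w. w \<in> set_pmf \<tau> \<Longrightarrow> snd (fst w) = fst (snd w)"
    by (rule glue_couplings[of \<omega> \<omega>']) (simp_all add: \<omega>(2) \<omega>'(1))
  have "(\<integral>\<^sup>+w. ennreal (d (fst (fst w)) (snd (snd w))) \<partial>measure_pmf \<tau>) \<le>
      (\<integral>\<^sup>+w. ennreal (d (fst (fst w)) (snd (fst w))) + ennreal (d (fst (snd w)) (snd (snd w))) \<partial>measure_pmf \<tau>)"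
  proof (intro nn_integral_mono_AE AE_pmfI)
    fix w assume "w \<in> set_pmf \<tau>"
    with glued triangle[of "fst (fst w)" "snd (snd w)" "fst (snd w)"]
    show "ennreal (d (fst (fst w)) (snd (snd w))) \<le>
        ennreal (d (fst (fst w)) (snd (fst w))) + ennreal (d (fst (snd w)) (snd (snd w)))"
      using nonneg(1) by (simp add: ennreal_leI flip: ennreal_plus)
  qed
  also have "\<dots> = (\<integral>\<^sup>+z. ennreal (d (fst z) (snd z)) \<partial>map_pmf fst \<tau>) +
      (\<integral>\<^sup>+z. ennreal (d (fst z) (snd z)) \<partial>map_pmf snd \<tau>)"
    by (simp add: nn_integral_add)
  also have "\<dots> \<le> ennreal (K + K')"
    unfolding \<tau> using cost cost' nonneg(2,3) by (simp add: add_mono)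
  finally show ?thesis
    by (intro coupled_withinI[where \<omega> = "map_pmf (\<lambda>w. (fst (fst w), snd (snd w))) \<tau>"])
      (simp_all add: map_pmf_comp \<omega>(1)[symmetric] \<omega>'(2)[symmetric] flip: \<tau>)
qed

lemma coupled_within_bind_pmf:
  assumes coupled: "\<And>i. i \<in> set_pmf p \<Longrightarrow> coupled_within d (k i) (f i) (g i)"
    and cost: "(\<integral>\<^sup>+i. ennreal (k i) \<partial>measure_pmf p) \<le> ennreal K"
  shows "coupled_within d K (bind_pmf p f) (bind_pmf p g)"
proof -
  have "\<exists>\<omega>. \<omega> \<in> couplings (f i) (g i) \<and>
      (\<integral>\<^sup>+z. ennreal (d (fst z) (snd z)) \<partial>measure_pmf \<omega>) \<le> ennreal (k i)" if "i \<in> set_pmf p" for i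
    using coupled[OF that] unfolding coupled_within_def by blast
  then obtain \<omega> where \<omega>: "\<And>i. i \<in> set_pmf p \<Longrightarrow> \<omega> i \<in> couplings (f i) (g i)"
    and cost_\<omega>: "\<And>i. i \<in> set_pmf p \<Longrightarrow>
      (\<integral>\<^sup>+z. ennreal (d (fst z) (snd z)) \<partial>measure_pmf (\<omega> i)) \<le> ennreal (k i)"
    by metis
  have "(\<integral>\<^sup>+z. ennreal (d (fst z) (snd z)) \<partial>measure_pmf (bind_pmf p \<omega>)) \<le>
      (\<integral>\<^sup>+i. ennreal (k i) \<partial>measure_pmf p)"
    using cost_\<omega> by (auto intro!: nn_integral_mono_AE AE_pmfI)
  also note cost
  finally show ?thesis
    using \<omega> by (intro coupled_withinI[where \<omega> = "bind_pmf p \<omega>"])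
      (auto simp: map_bind_pmf couplings_def intro!: bind_pmf_cong)
qed

lemma coupled_within_bind_pmf_of_set:
  assumes T: "finite T" "T \<noteq> {}" "S \<subseteq> T" and "0 \<le> C" and d: "\<And>x. d x x = 0"
    and coupled: "\<And>t. t \<in> S \<Longrightarrow> coupled_within d C (f t) (g t)"
    and same: "\<And>t. t \<in> T - S \<Longrightarrow> f t = g t"
  shows "coupled_within d (C * (real (card S) / real (card T)))
    (bind_pmf (pmf_of_set T) f) (bind_pmf (pmf_of_set T) g)"
proof (rule coupled_within_bind_pmf[where k = "\<lambda>t. C * indicator S t"])
  show "coupled_within d (C * indicator S t) (f t) (g t)" if "t \<in> set_pmf (pmf_of_set T)" for t
    using that T(1,2) coupled same by (cases "t \<in> S") (auto simp: coupled_within_refl d)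
  have "T \<inter> S = S" using T(3) by blast
  then show "(\<integral>\<^sup>+t. ennreal (C * indicator S t) \<partial>pmf_of_set T) \<le>
      ennreal (C * (real (card S) / real (card T)))"
    using T(1,2) \<open>0 \<le> C\<close>
    by (simp add: ennreal_mult' ennreal_indicator nn_integral_cmult emeasure_pmf_of_set
        del: times_divide_eq_right)
qed

lemma coupled_within_map_pmf:
  assumes "coupled_within d K \<mu> \<nu>" "0 \<le> K" "0 \<le> k"
    and d: "\<And>x y. 0 \<le> d x y" "\<And>x y. d' (f x) (g y) \<le> d x y + k"
  shows "coupled_within d' (K + k) (map_pmf f \<mu>) (map_pmf g \<nu>)"
proof -
  obtain \<omega> where \<omega>: "map_pmf fst \<omega> = \<mu>" "map_pmf snd \<omega> = \<nu>"
    and cost: "(\<integral>\<^sup>+z. ennreal (d (fst z) (snd z)) \<partial>measure_pmf \<omega>) \<le> ennreal K"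
    using assms(1) by (rule coupled_withinE)
  have "(\<integral>\<^sup>+z. ennreal (d' (f (fst z)) (g (snd z))) \<partial>measure_pmf \<omega>) \<le>
      (\<integral>\<^sup>+z. ennreal (d (fst z) (snd z)) + ennreal k \<partial>measure_pmf \<omega>)"
    using assms(3) d by (auto intro!: nn_integral_mono ennreal_leI simp flip: ennreal_plus)
  also have "\<dots> = (\<integral>\<^sup>+z. ennreal (d (fst z) (snd z)) \<partial>measure_pmf \<omega>) + ennreal k"
    by (simp add: nn_integral_add)
  also have "\<dots> \<le> ennreal (K + k)"
    using cost assms(2,3) by (simp add: add_mono)
  finally show ?thesis
    using \<omega> by (intro coupled_withinI[where \<omega> = "map_pmf (map_prod f g) \<omega>"])
      (auto simp: map_pmf_comp)
qed

lemma bind_map_pmf_cond_pmf: "bind_pmf (map_pmf f \<mu>) (\<lambda>c. cond_pmf \<mu> {x. f x = c}) = \<mu>"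
proof -
  have "bind_pmf (map_pmf f \<mu>) (\<lambda>c. cond_pmf \<mu> {x. c = f x}) = \<mu>"
    by (intro bind_cond_pmf_cancel) (force simp: vimage_def eq_commute)+
  then show ?thesis by (simp add: eq_commute)
qed

lemma coupled_within_cond_pmf:
  assumes "\<And>c. c \<in> f ` set_pmf \<nu> \<Longrightarrow> coupled_within d K \<mu> (cond_pmf \<nu> {x. f x = c})"
  shows "coupled_within d K \<mu> \<nu>"
proof -
  have "coupled_within d K (bind_pmf (map_pmf f \<nu>) (\<lambda>_. \<mu>))
      (bind_pmf (map_pmf f \<nu>) (\<lambda>c. cond_pmf \<nu> {x. f x = c}))"
    using assms by (intro coupled_within_bind_pmf[where k = "\<lambda>_. K"]) auto
  then show ?thesis
    by (simp add: bind_map_pmf_cond_pmf)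
qed

lemma cond_pmf_of_set:
  assumes "finite A" "A \<inter> B \<noteq> {}"
  shows "cond_pmf (pmf_of_set A) B = pmf_of_set (A \<inter> B)"
proof (rule pmf_eqI)
  fix x
  have "A \<noteq> {}" using assms(2) by blast
  with assms show "pmf (cond_pmf (pmf_of_set A) B) x = pmf (pmf_of_set (A \<inter> B)) x"
    by (simp add: pmf_cond measure_pmf_of_set indicator_def card_gt_0_iff)
qed

section \<open>Coupling uniform distributions fiber by fiber\<close>

definition padded_fiber :: "('a \<Rightarrow> 'i) \<Rightarrow> 'a set \<Rightarrow> 'i \<Rightarrow> nat \<Rightarrow> 'a set" where
  "padded_fiber f X i m = (if m < card {x \<in> X. f x = i} then {x \<in> X. f x = i} else X)"

lemma sum_pmf_padded_fiber:
  assumes X: "finite X" "X \<noteq> {}" and n: "card {x \<in> X. f x = i} \<le> n"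
  shows "(\<Sum>m<n. pmf (pmf_of_set (padded_fiber f X i m)) x) =
    indicator {x \<in> X. f x = i} x + (real n - card {x \<in> X. f x = i}) * pmf (pmf_of_set X) x"
proof -
  let ?c = "card {x \<in> X. f x = i}"
  have "(\<Sum>m<n. pmf (pmf_of_set (padded_fiber f X i m)) x) =
      (\<Sum>m<?c. pmf (pmf_of_set (padded_fiber f X i m)) x) +
      (\<Sum>m=?c..<n. pmf (pmf_of_set (padded_fiber f X i m)) x)"
    using n by (subst sum.atLeastLessThan_concat[of 0 ?c n, symmetric, simplified atLeast0LessThan]) auto
  also have "(\<Sum>m<?c. pmf (pmf_of_set (padded_fiber f X i m)) x) =
      ?c * pmf (pmf_of_set {x \<in> X. f x = i}) x"
    by (simp add: padded_fiber_def)
  also have "\<dots> = indicator {x \<in> X. f x = i} x"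
    using X(1) by (cases "{x \<in> X. f x = i} = {}") (simp_all del: Collect_empty_eq)
  also have "(\<Sum>m=?c..<n. pmf (pmf_of_set (padded_fiber f X i m)) x) =
      (real n - ?c) * pmf (pmf_of_set X) x"
    using n by (simp add: padded_fiber_def)
  finally show ?thesis .
qed

lemma bind_pmf_of_set_padded_fiber:
  assumes X: "finite X" "X \<noteq> {}" and I: "finite I" "f ` X \<subseteq> I"
    and n: "\<And>i. i \<in> I \<Longrightarrow> card {x \<in> X. f x = i} \<le> n i"
  shows "bind_pmf (pmf_of_set (SIGMA i:I. {..<n i})) (\<lambda>(i, m). pmf_of_set (padded_fiber f X i m)) =
    pmf_of_set X"
proof (rule pmf_eqI)
  fix x
  let ?T = "SIGMA i:I. {..<n i}" and ?u = "pmf (pmf_of_set X) x"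
  have card_X: "card X = (\<Sum>i\<in>I. card {x \<in> X. f x = i})"
    using sum.group[OF X(1) I, of "\<lambda>_. 1::nat"] by simp
  also have "\<dots> \<le> card ?T"
    using n I by (simp add: sum_mono)
  finally have T: "0 < card ?T"
    using X by (metis card_gt_0_iff order_less_le_trans)
  have "(\<Sum>(i, m)\<in>?T. pmf (pmf_of_set (padded_fiber f X i m)) x) =
      (\<Sum>i\<in>I. indicator {x \<in> X. f x = i} x + (real (n i) - card {x \<in> X. f x = i}) * ?u)"
    using X I(1) n by (simp add: sum.Sigma[symmetric] sum_pmf_padded_fiber)
  also have "\<dots> = (\<Sum>i\<in>I. indicator {x \<in> X. f x = i} x) + ((\<Sum>i\<in>I. real (n i)) - card X) * ?u"
    by (simp add: sum.distrib card_X sum_subtractf flip: sum_distrib_right)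
  also have "(\<Sum>i\<in>I. indicator {x \<in> X. f x = i} x) = card X * ?u"
  proof -
    have "(\<Sum>i\<in>I. indicator {x \<in> X. f x = i} x) = (\<Sum>i\<in>I. if i = f x then indicator X x else 0 :: real)"
      by (intro sum.cong) (auto simp: indicator_def)
    also have "\<dots> = indicator X x"
      using I by (auto simp: indicator_def)
    finally show ?thesis using X by simp
  qed
  also have "card X * ?u + ((\<Sum>i\<in>I. real (n i)) - card X) * ?u = card ?T * ?u"
    using I(1) by (simp add: algebra_simps)
  finally show "pmf (bind_pmf (pmf_of_set ?T) (\<lambda>(i, m). pmf_of_set (padded_fiber f X i m))) x = ?u"
    using T by (subst pmf_bind_pmf_of_set) (auto simp: split_beta card_gt_0_iff)
qed

lemma coupled_within_pmf_of_set_common_fiber: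
  fixes X Y :: "'a set" and f g :: "'a \<Rightarrow> 'i"
  assumes n_def: "\<And>i. n i = max (card {x \<in> X. f x = i}) (card {y \<in> Y. g y = i})"
    and X: "finite X" "X \<noteq> {}" "f ` X \<subseteq> insert j I"
    and Y: "finite Y" "Y \<noteq> {}" "g ` Y \<subseteq> insert j I"
    and I: "finite I" "j \<notin> I"
    and common: "{x \<in> X. f x = j} = {y \<in> Y. g y = j}"
    and few: "r * (\<Sum>i\<in>I. real (n i)) \<le> card {x \<in> X. f x = j}"
    and d: "\<And>x. d x x = 0" and nonneg: "0 \<le> r" "0 \<le> C"
    and coupled: "\<And>i m. i \<in> I \<Longrightarrow> m < n i \<Longrightarrow>
      coupled_within d C (pmf_of_set (padded_fiber f X i m)) (pmf_of_set (padded_fiber g Y i m))"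
  shows "coupled_within d (C / (1 + r)) (pmf_of_set X) (pmf_of_set Y)"
proof -
  define S T where "S = (SIGMA i:I. {..<n i})" and "T = (SIGMA i:insert j I. {..<n i})"
  have n: "card {x \<in> X. f x = i} \<le> n i" "card {y \<in> Y. g y = i} \<le> n i" for i
    by (simp_all add: n_def)
  have "finite T" "S \<subseteq> T" using I(1) by (auto simp: S_def T_def)
  have "T \<noteq> {}"
  proof -
    obtain x where "x \<in> X" using X(2) by blast
    then have "0 < card {y \<in> X. f y = f x}"
      using X(1) by (auto simp: card_gt_0_iff)
    then have "(f x, 0) \<in> T"
      using n(1)[of "f x"] \<open>x \<in> X\<close> X(3) by (auto simp: T_def)
    then show ?thesis by blast
  qed
  have "r * card S \<le> n j"
    using few common I(1) by (simp add: S_def n_def)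
  then have "(1 + r) * card S \<le> card T"
    using I by (simp add: S_def T_def algebra_simps)
  then have "real (card S) / real (card T) \<le> 1 / (1 + r)"
    using \<open>finite T\<close> \<open>T \<noteq> {}\<close> nonneg(1) by (simp add: field_simps card_gt_0_iff)
  from mult_left_mono[OF this nonneg(2)] have cost: "C * (real (card S) / real (card T)) \<le> C / (1 + r)"
    by simp
  have "coupled_within d (C * (real (card S) / real (card T)))
      (bind_pmf (pmf_of_set T) (\<lambda>(i, m). pmf_of_set (padded_fiber f X i m)))
      (bind_pmf (pmf_of_set T) (\<lambda>(i, m). pmf_of_set (padded_fiber g Y i m)))"
  proof (rule coupled_within_bind_pmf_of_set[OF \<open>finite T\<close> \<open>T \<noteq> {}\<close> \<open>S \<subseteq> T\<close> nonneg(2) d])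
    fix t assume "t \<in> T - S"
    then have "fst t = j" "snd t < card {x \<in> X. f x = j}"
      using common by (auto simp: S_def T_def n_def)
    then show "(case t of (i, m) \<Rightarrow> pmf_of_set (padded_fiber f X i m)) =
        (case t of (i, m) \<Rightarrow> pmf_of_set (padded_fiber g Y i m))"
      using common by (simp add: split_beta padded_fiber_def)
  qed (use coupled in \<open>auto simp: S_def\<close>)
  then show ?thesis
    using coupled_within_mono[OF _ cost] X Y I(1) n
    unfolding T_def by (simp add: bind_pmf_of_set_padded_fiber)
qed

section \<open>Hamming distance and proper edge colorings\<close>

lemma hamming_nonneg: "0 \<le> hamming S x y"
  by (simp add: hamming_def)

lemma hamming_self: "hamming S x x = 0"
  by (simp add: hamming_def)

lemma hamming_commute: "hamming S x y = hamming S y x"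
  by (simp add: hamming_def eq_commute)

lemma hamming_triangle:
  assumes "finite S"
  shows "hamming S x z \<le> hamming S x y + hamming S y z"
proof -
  have "card {e \<in> S. x e \<noteq> z e} \<le> card ({e \<in> S. x e \<noteq> y e} \<union> {e \<in> S. y e \<noteq> z e})"
    using assms by (intro card_mono) auto
  also have "\<dots> \<le> card {e \<in> S. x e \<noteq> y e} + card {e \<in> S. y e \<noteq> z e}"
    by (rule card_Un_le)
  finally show ?thesis by (simp add: hamming_def)
qed

lemma hamming_fun_upd_le:
  assumes "finite S"
  shows "hamming S (x(e := c)) (y(e := c')) \<le> hamming (S - {e}) x y + 1"
proof -
  have "card {f \<in> S. (x(e := c)) f \<noteq> (y(e := c')) f} \<le> card (insert e {f \<in> S - {e}. x f \<noteq> y f})"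
    using assms by (intro card_mono) auto
  also have "\<dots> \<le> Suc (card {f \<in> S - {e}. x f \<noteq> y f})"
    by (rule card_insert_le_m1) auto
  finally show ?thesis by (simp add: hamming_def)
qed

definition remove_color :: "('v set \<Rightarrow> nat set) \<Rightarrow> 'v set \<Rightarrow> nat \<Rightarrow> 'v set \<Rightarrow> nat set" where
  "remove_color L U c = (\<lambda>e. if e \<inter> U = {} then L e else L e - {c})"

lemma in_remove_color_iff: "x \<in> remove_color L U c e \<longleftrightarrow> x \<in> L e \<and> (e \<inter> U \<noteq> {} \<longrightarrow> x \<noteq> c)"
  by (simp add: remove_color_def)

lemma remove_color_subset: "remove_color L U c e \<subseteq> L e"
  by (simp add: remove_color_def)

lemma remove_color_commute:
  "remove_color (remove_color L U c) W c' = remove_color (remove_color L W c') U c"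
  by (auto simp: remove_color_def fun_eq_iff)

lemma remove_color_doubleton:
  "remove_color L {u, w} c = remove_color (remove_color L {u} c) {w} c"
  by (auto simp: remove_color_def fun_eq_iff)

lemma finite_edges: "list_edge_coloring_instance V E q L \<Longrightarrow> finite E"
  unfolding list_edge_coloring_instance_def finite_graph_def
  by (meson Pow_iff finite_Pow_iff finite_subset subsetI)

lemma list_edge_coloring_instance_lists:
  "list_edge_coloring_instance V E q L \<Longrightarrow> e \<in> E \<Longrightarrow> L e \<subseteq> {1..q}"
  by (simp add: list_edge_coloring_instance_def)

lemma list_edge_coloring_instance_endpoints:
  assumes "list_edge_coloring_instance V E q L" "e \<in> E"
  obtains u w where "e = {u, w}" "u \<noteq> w"
  using assms by (auto simp: list_edge_coloring_instance_def finite_graph_def card_2_iff)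

lemma list_edge_coloring_instance_subset:
  assumes "list_edge_coloring_instance V E q L" "F \<subseteq> E" "\<And>e. L' e \<subseteq> L e"
  shows "list_edge_coloring_instance V F q L'"
  using assms unfolding list_edge_coloring_instance_def finite_graph_def by blast

lemma proper_edge_colorings_subset: "proper_edge_colorings E q L \<subseteq> E \<rightarrow>\<^sub>E {1..q}"
  by (auto simp: proper_edge_colorings_def)

lemma finite_proper_edge_colorings: "finite E \<Longrightarrow> finite (proper_edge_colorings E q L)"
  by (rule finite_subset[OF proper_edge_colorings_subset]) (simp add: finite_PiE)

lemma proper_edge_colorings_mono:
  "(\<And>e. L e \<subseteq> L' e) \<Longrightarrow> proper_edge_colorings E q L \<subseteq> proper_edge_colorings E q L'"
  by (auto simp: proper_edge_colorings_def)

lemma proper_edge_coloring_fun_upd: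
  assumes "\<tau> \<in> proper_edge_colorings (E - {e}) q L" "e \<in> E" "c \<in> L e" "c \<in> {1..q}"
    and "\<And>f. f \<in> E - {e} \<Longrightarrow> f \<inter> e \<noteq> {} \<Longrightarrow> \<tau> f \<noteq> c"
  shows "\<tau>(e := c) \<in> proper_edge_colorings E q L"
  using assms
  by (auto simp: proper_edge_colorings_def PiE_iff extensional_def Int_commute)

lemma fun_upd_eq_extensionalD:
  assumes eq: "\<tau>(e := c) = \<tau>'(e := c')"
    and ext: "\<tau> \<in> extensional (S - {e})" "\<tau>' \<in> extensional (S - {e})"
  shows "\<tau> = \<tau>'" "c = c'"
proof
  show "\<tau> x = \<tau>' x" for x
    using fun_cong[OF eq, of x] ext by (cases "x = e") (auto simp: extensional_def)
  show "c = c'"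
    using fun_cong[OF eq, of e] by simp
qed

lemma proper_edge_colorings_extensional: "proper_edge_colorings E q L \<subseteq> extensional E"
  by (auto simp: proper_edge_colorings_def PiE_iff)

lemma card_available_colors_ge:
  assumes "finite E"
  shows "card (L e) - edge_degree E e \<le> card (L e - \<tau> ` {f \<in> E. f \<noteq> e \<and> f \<inter> e \<noteq> {}})"
proof -
  let ?N = "{f \<in> E. f \<noteq> e \<and> f \<inter> e \<noteq> {}}"
  have "card (\<tau> ` ?N) \<le> edge_degree E e"
    unfolding edge_degree_def using assms by (intro card_image_le) auto
  moreover have "card (L e) - card (\<tau> ` ?N) \<le> card (L e - \<tau> ` ?N)"
    using assms by (intro diff_card_le_card_Diff) auto
  ultimately show ?thesis by linarith
qed

lemma card_proper_edge_colorings_extend: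
  assumes inst: "list_edge_coloring_instance V E q L" and e: "e \<in> E"
  shows "(card (L e) - edge_degree E e) * card (proper_edge_colorings (E - {e}) q L) \<le>
    card (proper_edge_colorings E q L)"
proof -
  let ?P = "proper_edge_colorings (E - {e}) q L" and ?N = "{f \<in> E. f \<noteq> e \<and> f \<inter> e \<noteq> {}}"
  define avail where "avail \<tau> = L e - \<tau> ` ?N" for \<tau> :: "'a set \<Rightarrow> nat"
  have Le: "L e \<subseteq> {1..q}"
    using inst e by (rule list_edge_coloring_instance_lists)
  note fin = finite_edges[OF inst]
  have "card (L e) - edge_degree E e \<le> card (avail \<tau>)" for \<tau>
    unfolding avail_def by (rule card_available_colors_ge[OF fin])
  then have "(card (L e) - edge_degree E e) * card ?P \<le> (\<Sum>\<tau>\<in>?P. card (avail \<tau>))"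
    using sum_bounded_below[of ?P "card (L e) - edge_degree E e" "\<lambda>\<tau>. card (avail \<tau>)"]
    by (simp add: mult.commute)
  also have "\<dots> = card (Sigma ?P avail)"
    using fin Le by (subst card_SigmaI)
      (auto simp: avail_def finite_proper_edge_colorings intro: finite_subset)
  also have "\<dots> \<le> card (proper_edge_colorings E q L)"
  proof (rule card_inj_on_le)
    show "inj_on (\<lambda>(\<tau>, c). \<tau>(e := c)) (Sigma ?P avail)"
    proof (intro inj_onI, clarify)
      fix \<tau> c \<tau>' c' assume "\<tau> \<in> ?P" "\<tau>' \<in> ?P" and eq: "\<tau>(e := c) = \<tau>'(e := c')"
      then have "\<tau> \<in> extensional (E - {e})" "\<tau>' \<in> extensional (E - {e})"
        using proper_edge_colorings_extensional by blast+
      then show "\<tau> = \<tau>' \<and> c = c'"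
        using fun_upd_eq_extensionalD[OF eq] by blast
    qed
    show "(\<lambda>(\<tau>, c). \<tau>(e := c)) ` Sigma ?P avail \<subseteq> proper_edge_colorings E q L"
    proof clarify
      fix \<tau> c assume "\<tau> \<in> ?P" "c \<in> avail \<tau>"
      then show "\<tau>(e := c) \<in> proper_edge_colorings E q L"
        using e Le by (intro proper_edge_coloring_fun_upd) (auto simp: avail_def)
    qed
    show "finite (proper_edge_colorings E q L)"
      by (rule finite_proper_edge_colorings[OF fin])
  qed
  finally show ?thesis .
qed

lemma edge_degree_mono: "finite E \<Longrightarrow> F \<subseteq> E \<Longrightarrow> edge_degree F e \<le> edge_degree E e"
  unfolding edge_degree_def by (intro card_mono) auto

lemma vertex_degree_mono: "finite E \<Longrightarrow> F \<subseteq> E \<Longrightarrow> vertex_degree F v \<le> vertex_degree E v"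
  unfolding vertex_degree_def by (intro card_mono) auto

lemma proper_edge_colorings_nonempty:
  assumes inst: "list_edge_coloring_instance V E q L" and "extra \<beta> E L" "0 < \<beta>"
  shows "proper_edge_colorings E q L \<noteq> {}"
proof -
  have degree_less: "edge_degree E e < card (L e)" if "e \<in> E" for e
    using assms(2,3) that by (force simp: extra_def)
  have "proper_edge_colorings F q L \<noteq> {}" if "finite F" "F \<subseteq> E" for F
    using that
  proof (induction F rule: finite_induct)
    case empty
    have "(\<lambda>_. undefined) \<in> proper_edge_colorings {} q L"
      by (simp add: proper_edge_colorings_def)
    then show ?case by blast
  next
    case (insert e F)
    have "0 < card (L e) - edge_degree (insert e F) e"
      using degree_less[of e] edge_degree_mono[OF finite_edges[OF inst] insert.prems, of e] insert.prems
      by simp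
    moreover have "0 < card (proper_edge_colorings F q L)"
      using insert by (simp add: card_gt_0_iff finite_proper_edge_colorings)
    moreover have "list_edge_coloring_instance V (insert e F) q L"
      using inst insert.prems order_refl by (rule list_edge_coloring_instance_subset)
    ultimately have "0 < card (proper_edge_colorings (insert e F) q L)"
      using card_proper_edge_colorings_extend[of V "insert e F" q L e] insert.hyps
      by (metis Diff_insert_absorb insertI1 nat_0_less_mult_iff order_less_le_trans)
    then show ?case by (metis card.empty less_irrefl)
  qed
  then show ?thesis using finite_edges[OF inst] by blast
qed

lemma edge_degree_delete_edge:
  assumes "finite E" "e \<in> E" "f \<noteq> e"
  shows "edge_degree E f = edge_degree (E - {e}) f + of_bool (f \<inter> e \<noteq> {})"
proof (cases "f \<inter> e = {}")
  case True
  then have "{g \<in> E. g \<noteq> f \<and> g \<inter> f \<noteq> {}} = {g \<in> E - {e}. g \<noteq> f \<and> g \<inter> f \<noteq> {}}" by auto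
  with True show ?thesis by (simp add: edge_degree_def)
next
  case False
  then have "{g \<in> E. g \<noteq> f \<and> g \<inter> f \<noteq> {}} = insert e {g \<in> E - {e}. g \<noteq> f \<and> g \<inter> f \<noteq> {}}"
    using assms by auto
  with False assms show ?thesis by (simp add: edge_degree_def)
qed

lemma extra_remove_color:
  assumes "extra \<beta> E L"
  shows "extra (\<beta> - 1) E (remove_color L U c)"
  unfolding extra_def
proof
  fix e assume "e \<in> E"
  moreover have "card (L e) - 1 \<le> card (remove_color L U c e)"
    by (simp add: remove_color_def card_Diff_singleton_if)
  ultimately show "real (edge_degree E e) + (\<beta> - 1) \<le> card (remove_color L U c e)"
    using assms by (force simp: extra_def)
qed

lemma extra_delete_edge:
  assumes inst: "list_edge_coloring_instance V E q L" and ex: "extra \<beta> E L"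
    and e: "{u, w} \<in> E" "u \<noteq> w"
  shows "extra \<beta> (E - {{u, w}}) (remove_color (remove_color L {u} c) {w} c')"
  unfolding extra_def
proof
  fix f assume f: "f \<in> E - {{u, w}}"
  then have "card f = 2"
    using inst by (auto simp: list_edge_coloring_instance_def finite_graph_def)
  then have "\<not> {u, w} \<subseteq> f"
    using f e(2) by (metis DiffE card_2_iff card.infinite card_subset_eq insertI1 zero_neq_numeral)
  then have "card (L f) \<le> card (remove_color (remove_color L {u} c) {w} c' f) + of_bool (f \<inter> {u, w} \<noteq> {})"
    by (auto simp: remove_color_def card_Diff_singleton_if)
  moreover have "edge_degree E f = edge_degree (E - {{u, w}}) f + of_bool (f \<inter> {u, w} \<noteq> {})"
    using finite_edges[OF inst] e(1) f by (intro edge_degree_delete_edge) auto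
  moreover have "real (edge_degree E f) + \<beta> \<le> card (L f)"
    using ex f by (auto simp: extra_def)
  ultimately show "real (edge_degree (E - {{u, w}}) f) + \<beta> \<le>
      card (remove_color (remove_color L {u} c) {w} c' f)"
    by linarith
qed

section \<open>Pinning an edge\<close>

definition pinned_colorings ::
    "'v set set \<Rightarrow> nat \<Rightarrow> ('v set \<Rightarrow> nat set) \<Rightarrow> 'v set \<Rightarrow> nat \<Rightarrow> ('v set \<Rightarrow> nat) set" where
  "pinned_colorings E q L e c = {\<sigma> \<in> proper_edge_colorings E q L. \<sigma> e = c}"

lemma finite_pinned_colorings: "finite E \<Longrightarrow> finite (pinned_colorings E q L e c)"
  by (simp add: pinned_colorings_def finite_proper_edge_colorings)

lemma pinned_colorings_eq_empty: "e \<in> E \<Longrightarrow> c \<notin> L e \<Longrightarrow> pinned_colorings E q L e c = {}"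
  by (auto simp: pinned_colorings_def proper_edge_colorings_def)

lemma pinned_colorings_eq_image:
  assumes inst: "list_edge_coloring_instance V E q L" and e: "e \<in> E" and c: "c \<in> L e"
  shows "pinned_colorings E q L e c =
    (\<lambda>\<tau>. \<tau>(e := c)) ` proper_edge_colorings (E - {e}) q (remove_color L e c)"
    (is "?A = ?upd ` ?B")
proof (intro equalityI subsetI)
  fix \<sigma> assume "\<sigma> \<in> ?A"
  then have \<sigma>: "\<sigma> \<in> proper_edge_colorings E q L" "\<sigma> e = c"
    by (simp_all add: pinned_colorings_def)
  then have "\<sigma> f \<noteq> c" if "f \<in> E" "f \<noteq> e" "f \<inter> e \<noteq> {}" for f
    using that \<sigma> e unfolding proper_edge_colorings_def by blast
  with \<sigma> have "\<sigma>(e := undefined) \<in> ?B"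
    by (auto simp: proper_edge_colorings_def PiE_iff extensional_def remove_color_def)
  moreover have "\<sigma> = ?upd (\<sigma>(e := undefined))" using \<sigma> by auto
  ultimately show "\<sigma> \<in> ?upd ` ?B"
    by (intro image_eqI[where f = ?upd and x = "\<sigma>(e := undefined)"])
next
  fix \<sigma> assume "\<sigma> \<in> ?upd ` ?B"
  then obtain \<tau> where \<tau>: "\<tau> \<in> ?B" "\<sigma> = \<tau>(e := c)" by blast
  have "\<tau> \<in> proper_edge_colorings (E - {e}) q L"
    using \<tau>(1) proper_edge_colorings_mono[of "remove_color L e c" L] remove_color_subset by blast
  moreover have "\<tau> f \<noteq> c" if "f \<in> E - {e}" "f \<inter> e \<noteq> {}" for f
  proof -
    have "\<tau> f \<in> remove_color L e c f"
      using \<tau>(1) that(1) by (simp add: proper_edge_colorings_def)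
    with that(2) show ?thesis by (simp add: in_remove_color_iff)
  qed
  moreover have "c \<in> {1..q}"
    using list_edge_coloring_instance_lists[OF inst e] c by blast
  ultimately have "\<tau>(e := c) \<in> proper_edge_colorings E q L"
    using e c by (intro proper_edge_coloring_fun_upd)
  then show "\<sigma> \<in> ?A" using \<tau>(2) by (simp add: pinned_colorings_def)
qed

lemma card_pinned_colorings_le:
  assumes inst: "list_edge_coloring_instance V E q L" and ex: "extra \<beta> E L"
    and e: "e \<in> E" "u \<in> e"
  shows "(\<beta> - 1) * card (pinned_colorings E q L e c) \<le>
    card (proper_edge_colorings E q (remove_color L {u} c))"
proof -
  let ?L' = "remove_color L {u} c"
  have fin: "finite (E - {e})" using finite_edges[OF inst] by simp
  have "card (pinned_colorings E q L e c) \<le>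
      card (proper_edge_colorings (E - {e}) q (remove_color L e c))"
  proof (cases "c \<in> L e")
    case True
    show ?thesis
      unfolding pinned_colorings_eq_image[OF inst e(1) True]
      by (rule card_image_le[OF finite_proper_edge_colorings[OF fin]])
  next
    case False
    with e(1) show ?thesis by (simp add: pinned_colorings_eq_empty)
  qed
  also have "\<dots> \<le> card (proper_edge_colorings (E - {e}) q ?L')"
    using e(2) by (intro card_mono finite_proper_edge_colorings[OF fin] proper_edge_colorings_mono)
      (auto simp: remove_color_def)
  finally have "(\<beta> - 1) * card (pinned_colorings E q L e c) \<le>
      real (card (?L' e) - edge_degree E e) * card (proper_edge_colorings (E - {e}) q ?L')"
    using extra_remove_color[OF ex, of "{u}" c] e(1)
    by (intro mult_mono) (auto simp: extra_def)
  also have "\<dots> \<le> card (proper_edge_colorings E q ?L')"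
    using card_proper_edge_colorings_extend[of V E q ?L' e] inst e(1)
      list_edge_coloring_instance_subset[where L' = ?L', OF inst order_refl remove_color_subset]
    by (metis of_nat_le_iff of_nat_mult)
  finally show ?thesis .
qed

lemma pinned_colorings_nonempty:
  assumes inst: "list_edge_coloring_instance V E q L" and ex: "extra \<beta> E L" "0 < \<beta>"
    and e: "e \<in> E" and c: "c \<in> L e"
  shows "pinned_colorings E q L e c \<noteq> {}"
proof -
  obtain u w where uw: "e = {u, w}" "u \<noteq> w"
    using inst e by (rule list_edge_coloring_instance_endpoints)
  have "list_edge_coloring_instance V (E - {e}) q (remove_color L e c)"
    using inst Diff_subset remove_color_subset by (rule list_edge_coloring_instance_subset)
  moreover have "extra \<beta> (E - {e}) (remove_color L e c)"
    using extra_delete_edge[OF inst ex(1)] e uw by (simp add: remove_color_doubleton)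
  ultimately have "proper_edge_colorings (E - {e}) q (remove_color L e c) \<noteq> {}"
    using ex(2) by (rule proper_edge_colorings_nonempty)
  then show ?thesis
    by (simp add: pinned_colorings_eq_image[OF inst e c])
qed

lemma pinned_uniform_edge_coloring_eq_pmf_of_set:
  assumes "finite E" "pinned_colorings E q L e c \<noteq> {}"
  shows "pinned (uniform_edge_coloring E q L) e c =
    pmf_of_set (pinned_colorings E q L e c)"
proof -
  have "proper_edge_colorings E q L \<inter> {\<sigma>. \<sigma> e = c} = pinned_colorings E q L e c"
    by (auto simp: pinned_colorings_def)
  with assms show ?thesis
    by (simp add: pinned_def uniform_edge_coloring_def cond_pmf_of_set finite_proper_edge_colorings)
qed

lemma pinned_uniform_edge_coloring:
  assumes inst: "list_edge_coloring_instance V E q L" and ex: "extra \<beta> E L" "0 < \<beta>"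
    and e: "e \<in> E" and c: "c \<in> L e"
  shows "pinned (uniform_edge_coloring E q L) e c =
    map_pmf (\<lambda>\<tau>. \<tau>(e := c)) (uniform_edge_coloring (E - {e}) q (remove_color L e c))"
proof -
  note fin = finite_edges[OF inst]
  let ?P = "proper_edge_colorings (E - {e}) q (remove_color L e c)"
  have nonempty: "pinned_colorings E q L e c \<noteq> {}"
    using inst ex e c by (rule pinned_colorings_nonempty)
  then have "?P \<noteq> {}"
    unfolding pinned_colorings_eq_image[OF inst e c] by blast
  moreover have "inj_on (\<lambda>\<tau>. \<tau>(e := c)) ?P"
    by (intro inj_onI) (meson fun_upd_eq_extensionalD(1) proper_edge_colorings_extensional subsetD)
  ultimately have "map_pmf (\<lambda>\<tau>. \<tau>(e := c)) (pmf_of_set ?P) = pmf_of_set ((\<lambda>\<tau>. \<tau>(e := c)) ` ?P)"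
    using fin by (intro map_pmf_of_set_inj) (auto simp: finite_proper_edge_colorings)
  then show ?thesis
    unfolding pinned_uniform_edge_coloring_eq_pmf_of_set[OF fin nonempty]
      pinned_colorings_eq_image[OF inst e c]
    by (simp add: uniform_edge_coloring_def)
qed

lemma marginal_pinned_uniform_edge_coloring:
  assumes inst: "list_edge_coloring_instance V E q L" and ex: "extra \<beta> E L" "0 < \<beta>"
    and e: "e \<in> E" and c: "c \<in> L e"
  shows "marginal (pinned (uniform_edge_coloring E q L) e c) E = pinned (uniform_edge_coloring E q L) e c"
  unfolding marginal_def
proof (rule map_pmf_idI)
  fix \<sigma> assume \<sigma>: "\<sigma> \<in> set_pmf (pinned (uniform_edge_coloring E q L) e c)"
  have "pinned_colorings E q L e c \<noteq> {}"
    using inst ex e c by (rule pinned_colorings_nonempty)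
  with \<sigma> have "\<sigma> \<in> proper_edge_colorings E q L"
    using finite_pinned_colorings[OF finite_edges[OF inst]]
    by (simp add: pinned_uniform_edge_coloring_eq_pmf_of_set finite_edges[OF inst])
      (simp add: pinned_colorings_def)
  then show "restrict \<sigma> E = \<sigma>"
    by (meson extensional_restrict proper_edge_colorings_extensional subsetD)
qed

lemma set_pmf_uniform_edge_coloring:
  assumes "list_edge_coloring_instance V E q L" "extra \<beta> E L" "0 < \<beta>"
  shows "set_pmf (uniform_edge_coloring E q L) = proper_edge_colorings E q L"
  unfolding uniform_edge_coloring_def
  by (rule set_pmf_of_set[OF proper_edge_colorings_nonempty[OF assms]
        finite_proper_edge_colorings[OF finite_edges[OF assms(1)]]])

section \<open>Changing the color removed at a vertex\<close>

definition vertex_coupling_independent :: "real \<Rightarrow> real \<Rightarrow> 'v set \<Rightarrow> 'v set set \<Rightarrow> nat \<Rightarrow> bool" where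
  "vertex_coupling_independent \<beta> D V E q \<longleftrightarrow>
     (\<forall>L u a b. list_edge_coloring_instance V E q L \<longrightarrow>
        extra \<beta> E (remove_color L {u} a) \<longrightarrow> extra \<beta> E (remove_color L {u} b) \<longrightarrow>
        coupled_within (hamming E) D (uniform_edge_coloring E q (remove_color L {u} a))
          (uniform_edge_coloring E q (remove_color L {u} b)))"

lemma vertex_coupling_independentD:
  assumes "vertex_coupling_independent \<beta> D V E q" "list_edge_coloring_instance V E q L"
    and "extra \<beta> E (remove_color L {u} a)" "extra \<beta> E (remove_color L {u} b)"
  shows "coupled_within (hamming E) D (uniform_edge_coloring E q (remove_color L {u} a))
    (uniform_edge_coloring E q (remove_color L {u} b))"
  using assms unfolding vertex_coupling_independent_def by blast

definition color_class_at :: "'v set set \<Rightarrow> 'v \<Rightarrow> nat \<Rightarrow> ('v set \<Rightarrow> nat) \<Rightarrow> 'v set set" where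
  "color_class_at E u c \<sigma> = {e \<in> E. u \<in> e \<and> \<sigma> e = c}"

lemma color_class_at_eq_singleton:
  assumes "\<sigma> \<in> proper_edge_colorings E q L" "e \<in> E" "u \<in> e"
  shows "color_class_at E u c \<sigma> = {e} \<longleftrightarrow> \<sigma> e = c"
proof -
  have "\<sigma> f \<noteq> \<sigma> e" if "f \<in> E" "f \<noteq> e" "u \<in> f" for f
  proof -
    have "f \<inter> e \<noteq> {}" using that(3) assms(3) by blast
    with assms(1,2) that(1,2) show ?thesis by (simp add: proper_edge_colorings_def)
  qed
  with assms(2,3) show ?thesis by (auto simp: color_class_at_def)
qed

lemma color_class_at_subset_singletons:
  "color_class_at E u c ` proper_edge_colorings E q L \<subseteq> insert {} ((\<lambda>e. {e}) ` {e \<in> E. u \<in> e})"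
proof (intro image_subsetI)
  fix \<sigma> assume \<sigma>: "\<sigma> \<in> proper_edge_colorings E q L"
  show "color_class_at E u c \<sigma> \<in> insert {} ((\<lambda>e. {e}) ` {e \<in> E. u \<in> e})"
  proof (cases "color_class_at E u c \<sigma> = {}")
    case False
    then obtain e where "e \<in> E" "u \<in> e" "\<sigma> e = c"
      unfolding color_class_at_def by blast
    then show ?thesis
      using color_class_at_eq_singleton[OF \<sigma>, of e u c] by simp
  qed simp
qed

lemma color_class_at_empty:
  "{\<sigma> \<in> proper_edge_colorings E q L. color_class_at E u c \<sigma> = {}} =
    proper_edge_colorings E q (remove_color L {u} c)"
proof -
  have "(\<forall>e\<in>E. \<sigma> e \<in> remove_color L {u} c e) \<longleftrightarrow> (\<forall>e\<in>E. \<sigma> e \<in> L e) \<and> color_class_at E u c \<sigma> = {}"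
    for \<sigma>
    by (auto simp: in_remove_color_iff color_class_at_def)
  then show ?thesis
    by (simp only: proper_edge_colorings_def mem_Collect_eq conj_ac)
qed

lemma color_class_at_singleton:
  assumes "e \<in> E" "u \<in> e"
  shows "{\<sigma> \<in> proper_edge_colorings E q L. color_class_at E u c \<sigma> = {e}} =
    pinned_colorings E q L e c"
  unfolding pinned_colorings_def using color_class_at_eq_singleton[OF _ assms]
  by (intro Collect_cong conj_cong refl)

lemma pmf_of_set_padded_color_class:
  assumes "finite E" "e \<in> E" "u \<in> e"
  shows "pmf_of_set (padded_fiber (color_class_at E u c) (proper_edge_colorings E q L) {e} m) =
    (if m < card (pinned_colorings E q L e c) then pinned (uniform_edge_coloring E q L) e c
     else uniform_edge_coloring E q L)"
proof -
  have "pinned_colorings E q L e c \<noteq> {}" if "m < card (pinned_colorings E q L e c)"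
    using that by auto
  then show ?thesis
    using pinned_uniform_edge_coloring_eq_pmf_of_set[OF assms(1)]
    by (simp add: padded_fiber_def color_class_at_singleton[OF assms(2,3)] uniform_edge_coloring_def)
qed

text \<open>The two uses are \<open>M = remove_color L {u} a\<close> with \<open>N = remove_color L {u} b\<close>, and \<open>M = N\<close> with \<open>a = b\<close>.\<close>

locale vertex_color_change =
  fixes V :: "'v set" and E :: "'v set set" and q :: nat and \<beta> D :: real
    and M N :: "'v set \<Rightarrow> nat set" and u :: 'v and a b :: nat
  assumes inst_M: "list_edge_coloring_instance V E q M" and extra_M: "extra \<beta> E M"
    and inst_N: "list_edge_coloring_instance V E q N" and extra_N: "extra \<beta> E N"
    and agree: "remove_color M {u} b = remove_color N {u} a"
    and indep: "\<And>e. e \<in> E \<Longrightarrow> u \<in> e \<Longrightarrow> vertex_coupling_independent \<beta> D V (E - {e}) q"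
    and \<beta>_pos: "0 < \<beta>" and D_nonneg: "0 \<le> D"
begin

lemma vertex_color_change_sym: "vertex_color_change V E q \<beta> D N M u b a"
  using inst_M extra_M inst_N extra_N agree[symmetric] indep \<beta>_pos D_nonneg by unfold_locales

lemma finite_E: "finite E"
  using inst_M by (rule finite_edges)

text \<open>After deleting the edge \<open>e = {u, w}\<close>, the two list assignments differ by \<open>a\<close> versus \<open>c\<close> at \<open>u\<close>
  and by \<open>b\<close> versus \<open>c\<close> at \<open>w\<close>; the removed color is changed first at \<open>u\<close>, then at \<open>w\<close>.\<close>

lemma coupled_within_pinned:
  assumes e: "e \<in> E" "u \<in> e" and b: "b \<in> M e" and c: "c \<in> N e"
  shows "coupled_within (hamming E) (2 * D + 1)
    (pinned (uniform_edge_coloring E q M) e b) (pinned (uniform_edge_coloring E q N) e c)"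
proof -
  obtain w where uw: "e = {u, w}" "u \<noteq> w"
    using list_edge_coloring_instance_endpoints[OF inst_M e(1)] e(2)
    by (metis insert_iff insert_commute singletonD)
  let ?E = "E - {e}"
  let ?unif = "\<lambda>x y. uniform_edge_coloring ?E q (remove_color (remove_color N {u} x) {w} y)"
  have inst: "list_edge_coloring_instance V ?E q (remove_color N U x)" for U x
    using inst_N Diff_subset remove_color_subset by (rule list_edge_coloring_instance_subset)
  have extra_ab: "extra \<beta> ?E (remove_color (remove_color N {u} a) {w} b)"
    using extra_delete_edge[OF inst_M extra_M] e(1) uw by (simp flip: agree)
  have extra_c: "extra \<beta> ?E (remove_color (remove_color N {u} c) {w} y)" for y
    using extra_delete_edge[OF inst_N extra_N] e(1) uw by simp
  have change_u: "coupled_within (hamming ?E) D (?unif a b) (?unif c b)"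
    using vertex_coupling_independentD[OF indep[OF e] inst[of "{w}" b], of u a c] extra_ab extra_c
    by (simp add: remove_color_commute[of N "{w}" b "{u}"])
  have change_w: "coupled_within (hamming ?E) D (?unif c b) (?unif c c)"
    by (rule vertex_coupling_independentD[OF indep[OF e] inst extra_c extra_c])
  have "coupled_within (hamming ?E) (D + D) (?unif a b) (?unif c c)"
    using change_u change_w hamming_triangle hamming_nonneg D_nonneg D_nonneg
    by (rule coupled_within_trans) (use finite_E in simp)
  then have "coupled_within (hamming E) (D + D + 1)
      (map_pmf (\<lambda>\<tau>. \<tau>(e := b)) (?unif a b)) (map_pmf (\<lambda>\<tau>. \<tau>(e := c)) (?unif c c))"
    by (rule coupled_within_map_pmf) (use D_nonneg finite_E in \<open>simp_all add: hamming_nonneg hamming_fun_upd_le\<close>)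
  then show ?thesis
    using pinned_uniform_edge_coloring[OF inst_M extra_M \<beta>_pos e(1) b]
      pinned_uniform_edge_coloring[OF inst_N extra_N \<beta>_pos e(1) c]
    by (simp add: uw(1) remove_color_doubleton agree)
qed

lemma coupled_within_pinned_unpinned:
  assumes e: "e \<in> E" "u \<in> e" and b: "b \<in> M e"
  shows "coupled_within (hamming E) (2 * D + 1)
    (pinned (uniform_edge_coloring E q M) e b) (uniform_edge_coloring E q N)"
proof (rule coupled_within_cond_pmf[where f = "\<lambda>\<sigma>. \<sigma> e"], fold pinned_def)
  fix c assume "c \<in> (\<lambda>\<sigma>. \<sigma> e) ` set_pmf (uniform_edge_coloring E q N)"
  then have "c \<in> N e"
    using e(1) by (auto simp: set_pmf_uniform_edge_coloring[OF inst_N extra_N \<beta>_pos]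
        proper_edge_colorings_def)
  with e b show "coupled_within (hamming E) (2 * D + 1)
      (pinned (uniform_edge_coloring E q M) e b) (pinned (uniform_edge_coloring E q N) e c)"
    by (rule coupled_within_pinned)
qed

lemma coupled_within_padded_color_class:
  assumes e: "e \<in> E" "u \<in> e"
    and m: "m < max (card (pinned_colorings E q M e b)) (card (pinned_colorings E q N e a))"
  shows "coupled_within (hamming E) (2 * D + 1)
    (pmf_of_set (padded_fiber (color_class_at E u b) (proper_edge_colorings E q M) {e} m))
    (pmf_of_set (padded_fiber (color_class_at E u a) (proper_edge_colorings E q N) {e} m))"
proof -
  interpret sym: vertex_color_change V E q \<beta> D N M u b a
    by (rule vertex_color_change_sym)
  have color_available: "c \<in> L e" if "m < card (pinned_colorings E q L e c)" for L c
    using that e(1) pinned_colorings_eq_empty[of e E c L q] by (cases "c \<in> L e") simp_all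
  let ?X = "pinned_colorings E q M e b" and ?Y = "pinned_colorings E q N e a"
  note b = color_available[where L = M and c = b] and a = color_available[where L = N and c = a]
  note padded = pmf_of_set_padded_color_class[OF finite_E e]
  consider (both) "m < card ?X" "m < card ?Y" | (only_M) "m < card ?X" "\<not> m < card ?Y"
    | (only_N) "\<not> m < card ?X" "m < card ?Y"
    using m by linarith
  then show ?thesis
  proof cases
    case both
    then show ?thesis using coupled_within_pinned[OF e b a] by (simp add: padded)
  next
    case only_M
    then show ?thesis using coupled_within_pinned_unpinned[OF e b] by (simp add: padded)
  next
    case only_N
    then show ?thesis
      using coupled_within_sym[OF sym.coupled_within_pinned_unpinned[OF e a] hamming_commute]
      by (simp add: padded)
  qed
qed

lemma sum_card_pinned_colorings_le:
  fixes r :: real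
  assumes r: "r * vertex_degree E u \<le> \<beta> - 1"
  shows "r * (\<Sum>e\<in>{e \<in> E. u \<in> e}.
      real (max (card (pinned_colorings E q M e b)) (card (pinned_colorings E q N e a)))) \<le>
    card (proper_edge_colorings E q (remove_color M {u} b))"
proof -
  define J where "J = {e \<in> E. u \<in> e}"
  define n where "n e = real (max (card (pinned_colorings E q M e b)) (card (pinned_colorings E q N e a)))" for e
  define z where "z = real (card (proper_edge_colorings E q (remove_color M {u} b)))"
  have class_small: "r * n e \<le> z / card J" if "e \<in> J" for e
  proof -
    have "r * card J * n e \<le> (\<beta> - 1) * n e"
      using r by (intro mult_right_mono) (simp_all add: J_def vertex_degree_def n_def)
    also have "\<dots> \<le> z"
      using card_pinned_colorings_le[OF inst_M extra_M, of e u b]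
        card_pinned_colorings_le[OF inst_N extra_N, of e u a] that
      by (simp add: agree J_def n_def z_def max_def)
    finally have "r * card J * n e \<le> z" .
    moreover have "0 < card J"
      using that finite_E by (auto simp: J_def card_gt_0_iff)
    ultimately show ?thesis by (simp add: pos_le_divide_eq mult_ac)
  qed
  have "(\<Sum>e\<in>J. r * n e) \<le> card J * (z / card J)"
    using class_small by (rule sum_bounded_above)
  also have "\<dots> \<le> z" by (simp add: z_def)
  finally show ?thesis by (simp add: J_def n_def z_def sum_distrib_left)
qed

lemma coupled_within_uniform_edge_coloring:
  fixes r :: real
  assumes r: "r * vertex_degree E u \<le> \<beta> - 1" "0 \<le> r"
  shows "coupled_within (hamming E) ((2 * D + 1) / (1 + r))
    (uniform_edge_coloring E q M) (uniform_edge_coloring E q N)"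
proof -
  let ?P = "proper_edge_colorings E q"
  let ?f = "color_class_at E u b" and ?g = "color_class_at E u a"
  let ?J = "{e \<in> E. u \<in> e}"
  define n where "n i = max (card {\<sigma> \<in> ?P M. ?f \<sigma> = i}) (card {\<sigma> \<in> ?P N. ?g \<sigma> = i})" for i
  have n: "n {e} = max (card (pinned_colorings E q M e b)) (card (pinned_colorings E q N e a))"
    if "e \<in> ?J" for e
    using that by (simp add: n_def color_class_at_singleton)
  have "coupled_within (hamming E) ((2 * D + 1) / (1 + r)) (pmf_of_set (?P M)) (pmf_of_set (?P N))"
  proof (rule coupled_within_pmf_of_set_common_fiber[OF n_def, where j = "{}" and I = "(\<lambda>e. {e}) ` ?J"])
    show "finite (?P M)" "finite (?P N)"
      by (rule finite_proper_edge_colorings[OF finite_E])+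
    show "?P M \<noteq> {}" "?P N \<noteq> {}"
      by (rule proper_edge_colorings_nonempty[OF inst_M extra_M \<beta>_pos]
          proper_edge_colorings_nonempty[OF inst_N extra_N \<beta>_pos])+
    show "?f ` ?P M \<subseteq> insert {} ((\<lambda>e. {e}) ` ?J)" "?g ` ?P N \<subseteq> insert {} ((\<lambda>e. {e}) ` ?J)"
      by (rule color_class_at_subset_singletons)+
    show "{\<sigma> \<in> ?P M. ?f \<sigma> = {}} = {\<sigma> \<in> ?P N. ?g \<sigma> = {}}"
      by (simp add: color_class_at_empty agree)
    have "(\<Sum>i\<in>(\<lambda>e. {e}) ` ?J. real (n i)) =
        (\<Sum>e\<in>?J. real (max (card (pinned_colorings E q M e b)) (card (pinned_colorings E q N e a))))"
      using n by (simp add: sum.reindex)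
    then show "r * (\<Sum>i\<in>(\<lambda>e. {e}) ` ?J. real (n i)) \<le> card {\<sigma> \<in> ?P M. ?f \<sigma> = {}}"
      using sum_card_pinned_colorings_le[OF r(1)] by (simp add: color_class_at_empty)
    show "coupled_within (hamming E) (2 * D + 1)
        (pmf_of_set (padded_fiber ?f (?P M) i m)) (pmf_of_set (padded_fiber ?g (?P N) i m))"
      if "i \<in> (\<lambda>e. {e}) ` ?J" "m < n i" for i m
      using that n by (auto intro!: coupled_within_padded_color_class)
  qed (use finite_E r(2) D_nonneg in \<open>auto simp: hamming_self\<close>)
  then show ?thesis
    by (simp add: uniform_edge_coloring_def)
qed

end

lemma vertex_coupling_independent_step:
  fixes V :: "'v set"
  assumes "\<And>e. e \<in> E \<Longrightarrow>
      vertex_coupling_independent ((1 + \<epsilon>) * real \<Delta> + 1) (1 / \<epsilon>) V (E - {e}) q"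
    and deg: "\<And>v. vertex_degree E v \<le> \<Delta>" and \<epsilon>: "0 < \<epsilon>"
  shows "vertex_coupling_independent ((1 + \<epsilon>) * real \<Delta> + 1) (1 / \<epsilon>) V E q"
  unfolding vertex_coupling_independent_def
proof (intro allI impI)
  fix L :: "'v set \<Rightarrow> nat set" and u :: 'v and a b
  let ?\<beta> = "(1 + \<epsilon>) * real \<Delta> + 1"
  let ?M = "remove_color L {u} a" and ?N = "remove_color L {u} b"
  assume inst: "list_edge_coloring_instance V E q L" and ex: "extra ?\<beta> E ?M" "extra ?\<beta> E ?N"
  have inst': "list_edge_coloring_instance V E q (remove_color L {u} c)" for c
    using inst order_refl remove_color_subset by (rule list_edge_coloring_instance_subset)
  interpret vertex_color_change V E q ?\<beta> "1 / \<epsilon>" ?M ?N u a b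
  proof
    show "remove_color ?M {u} b = remove_color ?N {u} a" by (rule remove_color_commute)
    show "0 < ?\<beta>" "0 \<le> 1 / \<epsilon>" using \<epsilon> by (simp_all add: add_nonneg_pos)
  qed (use inst' ex assms(1) in blast)+
  have "(1 + \<epsilon>) * vertex_degree E u \<le> ?\<beta> - 1"
    using deg[of u] \<epsilon> by simp
  then have "coupled_within (hamming E) ((2 * (1 / \<epsilon>) + 1) / (1 + (1 + \<epsilon>)))
      (uniform_edge_coloring E q ?M) (uniform_edge_coloring E q ?N)"
    using \<epsilon> by (intro coupled_within_uniform_edge_coloring) simp_all
  moreover have "2 * (1 / \<epsilon>) + 1 = (1 + (1 + \<epsilon>)) / \<epsilon>"
    using \<epsilon> by (simp add: field_simps)
  then have "(2 * (1 / \<epsilon>) + 1) / (1 + (1 + \<epsilon>)) = 1 / \<epsilon>"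
    using \<epsilon> by simp
  ultimately show
    "coupled_within (hamming E) (1 / \<epsilon>) (uniform_edge_coloring E q ?M) (uniform_edge_coloring E q ?N)"
    by simp
qed

lemma vertex_coupling_independent:
  assumes "finite E" "\<And>v. vertex_degree E v \<le> \<Delta>" and \<epsilon>: "0 < \<epsilon>"
  shows "vertex_coupling_independent ((1 + \<epsilon>) * real \<Delta> + 1) (1 / \<epsilon>) V E q"
  using assms(1,2)
proof (induction E rule: finite_psubset_induct)
  case (psubset E)
  show ?case
  proof (rule vertex_coupling_independent_step[OF _ psubset.prems \<epsilon>])
    fix e assume "e \<in> E"
    moreover have "vertex_degree (E - {e}) v \<le> \<Delta>" for v
      using vertex_degree_mono[OF psubset.hyps, of "E - {e}" v] psubset.prems[of v] by simp
    ultimately show "vertex_coupling_independent ((1 + \<epsilon>) * real \<Delta> + 1) (1 / \<epsilon>) V (E - {e}) q"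
      by (intro psubset.IH) auto
  qed
qed

lemma vertex_degree_le:
  assumes "list_edge_coloring_instance V E q L" "\<forall>v\<in>V. vertex_degree E v \<le> \<Delta>"
  shows "vertex_degree E v \<le> \<Delta>"
proof (cases "v \<in> V")
  case False
  then have no_edges: "{e \<in> E. v \<in> e} = {}"
    using assms(1) by (auto simp: list_edge_coloring_instance_def finite_graph_def)
  show ?thesis
    unfolding vertex_degree_def no_edges by simp
qed (use assms(2) in simp)

theorem theorem4p2:
  fixes V :: "'v set" and E :: "'v set set" and q :: nat and L :: "'v set \<Rightarrow> nat set"
    and \<Delta> :: nat and \<epsilon> :: real and \<mu> :: "('v set \<Rightarrow> nat) pmf"
    and i :: "'v set" and a b :: nat
  assumes "\<Delta> \<ge> 1"
    and "\<epsilon> > 0"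
    and "list_edge_coloring_instance V E q L"
    and "extra ((1 + \<epsilon>) * real \<Delta> + 1) E L"
    and "\<forall>v\<in>V. vertex_degree E v \<le> \<Delta>"
    and "\<mu> = uniform_edge_coloring E q L"
    and "i \<in> E"
    and "a \<in> L i"
    and "b \<in> L i"
  shows "wasserstein1 (hamming E) (marginal (pinned \<mu> i a) E) (marginal (pinned \<mu> i b) E)
           \<le> 1 + 2 / \<epsilon>"
proof -
  let ?\<beta> = "(1 + \<epsilon>) * real \<Delta> + 1"
  note inst = assms(3) and ex = assms(4)
  have \<beta>: "0 < ?\<beta>" using assms(2) by (simp add: add_nonneg_pos)
  obtain u w where u: "i = {u, w}"
    using inst assms(7) by (rule list_edge_coloring_instance_endpoints)
  have deg: "vertex_degree (E - {e}) v \<le> \<Delta>" for e v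
    using vertex_degree_mono[OF finite_edges[OF inst] Diff_subset] vertex_degree_le[OF inst assms(5)]
    by (rule order_trans)
  have "vertex_color_change V E q ?\<beta> (1 / \<epsilon>) L L u a a"
    using inst ex \<beta> assms(2) vertex_coupling_independent[OF _ deg assms(2)] finite_edges[OF inst]
    by unfold_locales auto
  then have "coupled_within (hamming E) (2 * (1 / \<epsilon>) + 1) (pinned \<mu> i a) (pinned \<mu> i b)"
    unfolding assms(6) using assms(7-9) u by (intro vertex_color_change.coupled_within_pinned) auto
  then have "wasserstein1 (hamming E) (pinned \<mu> i a) (pinned \<mu> i b) \<le> 2 * (1 / \<epsilon>) + 1"
    using hamming_nonneg by (rule wasserstein1_le) (use assms(2) in simp)
  moreover have "marginal (pinned \<mu> i c) E = pinned \<mu> i c" if "c \<in> L i" for c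
    unfolding assms(6) using inst ex \<beta> assms(7) that by (rule marginal_pinned_uniform_edge_coloring)
  ultimately show ?thesis
    using assms(8,9) by simp
qed

end
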